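(* Let $k\ge 2$. Then, as formal power series in $t$ with coefficients in $\mathbb{Q}(p,q,r,x)$, $$\sum_{n\ge 0}\frac{t^n}{[n]_{p,q}!}\sum_{(\sigma,w)\in C_k\wr S_n} q^{\mathrm{inv}(\sigma)}p^{\mathrm{coinv}(\sigma)}r^{\|w\|}x^{\mathrm{sris}(\sigma,w)}=\frac{1-x}{1-x+\sum_{n\ge 1}\frac{p^{\binom{n}{2}}((x-1)t)^n}{[n]_{p,q}!}r^{\binom{n}{2}}\begin{bmatrix} k\\ n\end{bmatrix}_r}.$$
   Context: For $k\ge 2$, $n\ge 0$, the wreath product $C_k\wr S_n$ is identified with the set of pairs $(\sigma,w)$ with $\sigma=\sigma_1\cdots\sigma_n\in S_n$ and $w=w_1\cdots w_n\in\{0,1,\dots,k-1\}^n$ (for $n=0$ there is exactly one, empty, element). $\mathrm{inv}(\sigma)=|\{i<j:\sigma_i>\sigma_j\}|$, $\mathrm{coinv}(\sigma)=|\{i<j:\sigma_i<\sigma_j\}|$, $\|w\|=w_1+\cdots+w_n$. The strict rise statistic is $\mathrm{sris}(\sigma,w)=|\{i\in\{1,\dots,n-1\}:\sigma_i<\sigma_{i+1}\text{ and } w_i< w_{i+1}\}|$. $[n]_{p,q}=\frac{p^n-q^n}{p-q}=p^{n-1}+p^{n-2}q+\cdots+q^{n-1}$, $[n]_{p,q}!=[n]_{p,q}\cdots[1]_{p,q}$ (with $[0]_{p,q}!=1$); $[n]_r=1+r+\cdots+r^{n-1}$, $[n]_r!=[n]_r\cdots[1]_r$, and $\begin{bmatrix}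 a\\ b\end{bmatrix}_r=\frac{[a]_r!}{[b]_r![a-b]_r!}$ for $0\le b\le a$, and $0$ if $b>a$. *)

theory Defs
  imports
    "HOL-Combinatorics.Permutations"
    "HOL-Library.FuncSet"
    "HOL-Computational_Algebra.Polynomial"
    "HOL-Computational_Algebra.Fraction_Field"
    "HOL-Computational_Algebra.Formal_Power_Series"
begin

text \<open>
  Words \<open>w\<close> are extensional functions, so that for each \<open>n\<close> there are exactly \<open>k ^ n\<close> of them.
\<close>

definition wreath :: "nat \<Rightarrow> nat \<Rightarrow> ((nat \<Rightarrow> nat) \<times> (nat \<Rightarrow> nat)) set" where
  "wreath k n = {\<sigma>. \<sigma> permutes {1..n}} \<times> ({1..n} \<rightarrow>\<^sub>E {0..<k})"

definition perm_inv :: "nat \<Rightarrow> (nat \<Rightarrow> nat) \<Rightarrow> nat" where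
  "perm_inv n \<sigma> = card {(i, j). i \<in> {1..n} \<and> j \<in> {1..n} \<and> i < j \<and> \<sigma> i > \<sigma> j}"

definition perm_coinv :: "nat \<Rightarrow> (nat \<Rightarrow> nat) \<Rightarrow> nat" where
  "perm_coinv n \<sigma> = card {(i, j). i \<in> {1..n} \<and> j \<in> {1..n} \<and> i < j \<and> \<sigma> i < \<sigma> j}"

definition word_weight :: "nat \<Rightarrow> (nat \<Rightarrow> nat) \<Rightarrow> nat" where
  "word_weight n w = (\<Sum>i = 1..n. w i)"

definition sris :: "nat \<Rightarrow> (nat \<Rightarrow> nat) \<Rightarrow> (nat \<Rightarrow> nat) \<Rightarrow> nat" where
  "sris n \<sigma> w = card {i \<in> {1..<n}. \<sigma> i < \<sigma> (i + 1) \<and> w i < w (i + 1)}"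

definition pq_num :: "'a::field \<Rightarrow> 'a \<Rightarrow> nat \<Rightarrow> 'a" where
  "pq_num p q n = (\<Sum>i<n. p ^ (n - 1 - i) * q ^ i)"

definition pq_fact :: "'a::field \<Rightarrow> 'a \<Rightarrow> nat \<Rightarrow> 'a" where
  "pq_fact p q n = (\<Prod>i = 1..n. pq_num p q i)"

definition r_num :: "'a::field \<Rightarrow> nat \<Rightarrow> 'a" where
  "r_num r n = (\<Sum>i<n. r ^ i)"

definition r_fact :: "'a::field \<Rightarrow> nat \<Rightarrow> 'a" where
  "r_fact r n = (\<Prod>i = 1..n. r_num r i)"

definition r_binom :: "'a::field \<Rightarrow> nat \<Rightarrow> nat \<Rightarrow> 'a" where
  "r_binom r a b = (if b \<le> a then r_fact r a / (r_fact r b * r_fact r (a - b)) else 0)"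

text \<open>
  The field \<open>\<rat>(p, q, r, x)\<close> is the fraction field of \<open>\<rat>[p][q][r][x]\<close>; the indeterminate \<open>p\<close> lives
  at the innermost polynomial layer and \<open>x\<close> at the outermost one.
\<close>

type_synonym ratfun = "rat poly poly poly poly fract"

definition var_p :: ratfun where
  "var_p = Fract [:[:[:[:0, 1:]:]:]:] 1"

definition var_q :: ratfun where
  "var_q = Fract [:[:[:0, 1:]:]:] 1"

definition var_r :: ratfun where
  "var_r = Fract [:[:0, 1:]:] 1"

definition var_x :: ratfun where
  "var_x = Fract [:0, 1:] 1"

definition sris_gf :: "'a::field \<Rightarrow> 'a \<Rightarrow> 'a \<Rightarrow> 'a \<Rightarrow> nat \<Rightarrow> 'a fps" where
  "sris_gf p q r x k = Abs_fps (\<lambda>n. (1 / pq_fact p q n) *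
     (\<Sum>(\<sigma>, w)\<in>wreath k n.
        q ^ perm_inv n \<sigma> * p ^ perm_coinv n \<sigma> * r ^ word_weight n w * x ^ sris n \<sigma> w))"

text \<open>
  The sum over \<open>n \<ge> 1\<close> in the denominator, with \<open>((x - 1) t)\<^sup>n\<close> split into its coefficient
  \<open>(x - 1)\<^sup>n\<close> and the power \<open>t\<^sup>n\<close>.
\<close>

definition sris_denom_sum :: "'a::field \<Rightarrow> 'a \<Rightarrow> 'a \<Rightarrow> 'a \<Rightarrow> nat \<Rightarrow> 'a fps" where
  "sris_denom_sum p q r x k = Abs_fps (\<lambda>n. if n = 0 then 0 else
     p ^ (n choose 2) * (x - 1) ^ n / pq_fact p q n * r ^ (n choose 2) * r_binom r k n)"

end

theory Submission imports Defs begin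

text \<open>
  The Lehmer code turns a permutation into a word \<open>v\<close> with \<open>v\<^sub>i < i\<close> that has the same rises and whose
  letters carry the inversions and coinversions independently of each other. Pairs \<open>(\<sigma>, w)\<close> thus
  become words in the letters \<open>(v\<^sub>i, w\<^sub>i)\<close> weighted by a product over positions and by \<open>x\<close> to the number
  of rises. Writing \<open>x = 1 + (x - 1)\<close> at each rise and splitting off the final chain of marked rises
  gives a convolution recurrence. The weight of all chains of \<open>m\<close> letters factors into a sum over
  strictly increasing \<open>v\<close> and one over strictly increasing \<open>w\<close>; both are Gaussian binomial
  coefficients by the same hockey-stick identity, the second with \<open>(p, q) = (r, 1)\<close>. The recurrence is
  the coefficientwise form of the theorem.
\<close>

section \<open>Gaussian binomial coefficients in two parameters\<close>

lemma pq_num_Suc: "pq_num p q (Suc n) = p * pq_num p q n + q ^ n"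
proof -
  have "(\<Sum>i<n. p ^ (n - i) * q ^ i) = (\<Sum>i<n. p * (p ^ (n - 1 - i) * q ^ i))"
  proof (rule sum.cong)
    fix i assume "i \<in> {..<n}"
    then have "n - i = Suc (n - 1 - i)" by auto
    then show "p ^ (n - i) * q ^ i = p * (p ^ (n - 1 - i) * q ^ i)" by simp
  qed simp
  then show ?thesis by (simp add: pq_num_def sum_distrib_left)
qed

text \<open>The first \<open>b\<close> terms of the sum for \<open>a + b\<close> share the factor
  \<open>p ^ a\<close>, the remaining ones share \<open>q ^ b\<close>. This split drives the Pascal
  rule.\<close>

lemma pq_num_add: "pq_num p q (a + b) = p ^ a * pq_num p q b + q ^ b * pq_num p q a"
proof (induction a)
  case 0
  then show ?case by (simp add: pq_num_def)
next
  case (Suc a)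
  then show ?case by (simp add: pq_num_Suc algebra_simps power_add)
qed

lemma pq_fact_0 [simp]: "pq_fact p q 0 = 1"
  by (simp add: pq_fact_def)

lemma pq_fact_Suc: "pq_fact p q (Suc n) = pq_fact p q n * pq_num p q (Suc n)"
  by (simp add: pq_fact_def mult.commute)

lemma pq_fact_nonzero:
  assumes "\<And>n. n > 0 \<Longrightarrow> pq_num p q n \<noteq> 0"
  shows "pq_fact p q n \<noteq> 0"
  using assms by (simp add: pq_fact_def)

definition pq_binom :: "'a::field \<Rightarrow> 'a \<Rightarrow> nat \<Rightarrow> nat \<Rightarrow> 'a" where
  "pq_binom p q a b = (if b \<le> a then pq_fact p q a / (pq_fact p q b * pq_fact p q (a - b)) else 0)"

lemma r_num_eq_pq_num: "r_num r n = pq_num r 1 n"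
proof (induction n)
  case 0
  then show ?case by (simp add: r_num_def pq_num_def)
next
  case (Suc n)
  have "r_num r (Suc n) = r * r_num r n + 1"
    unfolding r_num_def by (subst sum.lessThan_Suc_shift) (simp add: sum_distrib_left)
  with Suc show ?case by (simp add: pq_num_Suc)
qed

lemma r_binom_eq_pq_binom: "r_binom r = pq_binom r 1"
  by (intro ext) (simp add: r_binom_def pq_binom_def r_fact_def pq_fact_def r_num_eq_pq_num)

lemma pq_binom_0_right:
  assumes "\<And>n. n > 0 \<Longrightarrow> pq_num p q n \<noteq> 0"
  shows "pq_binom p q n 0 = 1"
  using pq_fact_nonzero[OF assms] by (simp add: pq_binom_def)

text \<open>Pascal rule: for \<open>m < j\<close>, \<open>pq_num_add\<close> splits the top factor
  of the numerator, and each half cancels against one factor of the denominator.\<close>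

lemma pq_binom_Suc_Suc:
  assumes nz: "\<And>n. n > 0 \<Longrightarrow> pq_num p q n \<noteq> 0"
  shows "pq_binom p q (Suc j) (Suc m) =
    q ^ Suc m * pq_binom p q j (Suc m) + p ^ (j - m) * pq_binom p q j m"
proof (cases "m < j")
  case True
  then obtain d where d: "j = m + Suc d" using less_imp_Suc_add by fastforce
  define N where "N = pq_num p q"
  define F where "F = pq_fact p q"
  have F0: "F i \<noteq> 0" for i unfolding F_def by (rule pq_fact_nonzero[OF nz])
  have N0: "N (Suc i) \<noteq> 0" for i unfolding N_def by (rule nz) simp
  have FS: "F (Suc i) = F i * N (Suc i)" for i by (simp add: F_def N_def pq_fact_Suc)
  have key: "N (Suc j) = p ^ Suc d * N (Suc m) + q ^ Suc m * N (Suc d)"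
    using pq_num_add[of p q "Suc d" "Suc m"] by (simp add: N_def d add.commute)
  have "pq_binom p q (Suc j) (Suc m) = F j * N (Suc j) / (F m * N (Suc m) * (F d * N (Suc d)))"
    by (simp add: pq_binom_def d flip: F_def FS)
  also have "\<dots> = q ^ Suc m * (F j / (F m * N (Suc m) * F d)) +
      p ^ Suc d * (F j / (F m * (F d * N (Suc d))))"
    unfolding key using F0[of m] F0[of d] N0[of m] N0[of d]
    by (simp add: field_simps del: power_Suc)
  also have "\<dots> = q ^ Suc m * pq_binom p q j (Suc m) + p ^ (j - m) * pq_binom p q j m"
    by (simp add: pq_binom_def d flip: F_def FS del: power_Suc)
  finally show ?thesis .
next
  case False
  then show ?thesis
    using pq_fact_nonzero[of p q, OF nz] by (auto simp: pq_binom_def)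
qed

lemma Suc_choose_two: "Suc m choose 2 = (m choose 2) + m"
  by (simp add: numeral_2_eq_2)

text \<open>Here \<open>v\<close> is the last letter of a chain, at position \<open>Suc s\<close>,
  with \<open>s - v\<close> inversions. Raising \<open>j\<close> by one frees a factor
  \<open>q ^ Suc m\<close> from the old sum, and the Pascal rule absorbs the new term. The bound on
  \<open>j\<close> keeps the truncated subtractions exact.\<close>

lemma pq_binom_hockey_stick:
  assumes nz: "\<And>n. n > 0 \<Longrightarrow> pq_num p q n \<noteq> 0" and "j \<le> Suc s"
  shows "(\<Sum>v<j. q ^ (s - v) * p ^ v * (p ^ (m choose 2) * q ^ (m * (s - v)) * pq_binom p q v m)) =
    p ^ (Suc m choose 2) * q ^ (Suc m * (Suc s - j)) * pq_binom p q j (Suc m)"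
  using assms(2)
proof (induction j)
  case 0
  then show ?case by (simp add: pq_binom_def)
next
  case (Suc j)
  then have e: "Suc s - j = Suc (s - j)" by auto
  \<comment> \<open>For \<open>m > j\<close> both sides are 0 because the binomial vanishes.\<close>
  have pw: "p ^ (m choose 2) * p ^ j * pq_binom p q j m =
      p ^ (Suc m choose 2) * p ^ (j - m) * pq_binom p q j m"
    by (cases "m \<le> j") (simp_all add: Suc_choose_two pq_binom_def flip: power_add)
  have qw: "q ^ (Suc m * (s - j)) = q ^ (s - j) * q ^ (m * (s - j))"
    by (simp add: power_add)
  have "(\<Sum>v<Suc j. q ^ (s - v) * p ^ v *
        (p ^ (m choose 2) * q ^ (m * (s - v)) * pq_binom p q v m)) =
      p ^ (Suc m choose 2) * q ^ (Suc m * Suc (s - j)) * pq_binom p q j (Suc m) +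
      q ^ (Suc m * (s - j)) * (p ^ (m choose 2) * p ^ j * pq_binom p q j m)"
    unfolding sum.lessThan_Suc qw using Suc.IH[OF Suc_leD[OF Suc.prems]] by (simp add: e)
  also have "\<dots> = p ^ (Suc m choose 2) * q ^ (Suc m * (s - j)) *
      (q ^ Suc m * pq_binom p q j (Suc m) + p ^ (j - m) * pq_binom p q j m)"
    unfolding pw by (simp add: algebra_simps power_add)
  also have "\<dots> = p ^ (Suc m choose 2) * q ^ (Suc m * (Suc s - Suc j)) * pq_binom p q (Suc j) (Suc m)"
    by (simp only: pq_binom_Suc_Suc[OF nz] diff_Suc_Suc)
  finally show ?case .
qed

section \<open>Words weighted by their rises\<close>

context
  fixes X :: "nat \<Rightarrow> 'u set" and c :: "nat \<Rightarrow> 'u \<Rightarrow> 'a::comm_ring_1"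
    and R :: "'u \<Rightarrow> 'u \<Rightarrow> bool" and x :: 'a
begin

definition rises :: "nat \<Rightarrow> (nat \<Rightarrow> 'u) \<Rightarrow> nat" where
  "rises n u = card {i \<in> {1..<n}. R (u i) (u (i + 1))}"

definition word_sum :: "nat \<Rightarrow> 'a" where
  "word_sum n = (\<Sum>u\<in>Pi\<^sub>E {1..n} X. (\<Prod>i=1..n. c i (u i)) * x ^ rises n u)"

text \<open>Also counts a possible rise from the last letter of the word to the letter \<open>a\<close>.\<close>

definition word_sum_to :: "nat \<Rightarrow> 'u \<Rightarrow> 'a" where
  "word_sum_to n a = (\<Sum>u\<in>Pi\<^sub>E {1..n} X. (\<Prod>i=1..n. c i (u i)) * x ^ rises n u *
     (if n \<ge> 1 \<and> R (u n) a then x else 1))"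

text \<open>
  Sums over the chains \<open>u\<^sub>M\<^sub>+\<^sub>1, \<dots>, u\<^sub>M\<^sub>+\<^sub>m\<close> all of whose steps, including the one from the last
  letter to \<open>a\<close>, are rises.
\<close>

fun chain_sum :: "nat \<Rightarrow> nat \<Rightarrow> 'u \<Rightarrow> 'a" where
  "chain_sum M 0 a = 1"
| "chain_sum M (Suc m) a =
    (\<Sum>b | b \<in> X (Suc (M + m)) \<and> R b a. c (Suc (M + m)) b * chain_sum M m b)"

lemma sum_PiE_Suc:
  "(\<Sum>u\<in>Pi\<^sub>E {1..Suc n} X. f u) = (\<Sum>b\<in>X (Suc n). \<Sum>u\<in>Pi\<^sub>E {1..n} X. f (u(Suc n := b)))"
proof -
  have "{1..Suc n} = insert (Suc n) {1..n}" by auto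
  then have "(\<Sum>u\<in>Pi\<^sub>E {1..Suc n} X. f u) =
      (\<Sum>u\<in>(\<lambda>(y, g). g(Suc n := y)) ` (X (Suc n) \<times> Pi\<^sub>E {1..n} X). f u)"
    by (simp add: PiE_insert_eq)
  also have "\<dots> = (\<Sum>(b, u)\<in>X (Suc n) \<times> Pi\<^sub>E {1..n} X. f (u(Suc n := b)))"
    by (subst sum.reindex) (auto intro!: inj_combinator sum.cong)
  finally show ?thesis by (simp add: sum.cartesian_product)
qed

lemma rises_Suc:
  "x ^ rises (Suc n) (u(Suc n := b)) = x ^ rises n u * (if n \<ge> 1 \<and> R (u n) b then x else 1)"
proof -
  let ?A = "{i \<in> {1..<n}. R (u i) (u (i + 1))}"
  have "{i \<in> {1..<Suc n}. R ((u(Suc n := b)) i) ((u(Suc n := b)) (i + 1))} =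
      (if n \<ge> 1 \<and> R (u n) b then insert n ?A else ?A)"
    by (auto simp: less_Suc_eq)
  then show ?thesis by (simp add: rises_def)
qed

lemma prod_weight_Suc:
  "(\<Prod>i=1..Suc n. c i ((u(Suc n := b)) i)) = c (Suc n) b * (\<Prod>i=1..n. c i (u i))"
proof -
  have "(\<Prod>i=1..n. c i ((u(Suc n := b)) i)) = (\<Prod>i=1..n. c i (u i))"
    by (rule prod.cong) auto
  then show ?thesis by (simp add: mult.commute)
qed

lemma word_sum_0: "word_sum 0 = 1"
  by (simp add: word_sum_def rises_def)

lemma word_sum_Suc: "word_sum (Suc n) = (\<Sum>b\<in>X (Suc n). c (Suc n) b * word_sum_to n b)"
  unfolding word_sum_def word_sum_to_def
  by (simp only: sum_PiE_Suc rises_Suc prod_weight_Suc sum_distrib_left mult.assoc)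

lemma word_sum_to_0: "word_sum_to 0 a = 1"
  by (simp add: word_sum_to_def rises_def)

lemma word_sum_to_Suc:
  "word_sum_to (Suc n) a =
    (\<Sum>b\<in>X (Suc n). c (Suc n) b * word_sum_to n b * (if R b a then x else 1))"
proof -
  have "word_sum_to (Suc n) a = (\<Sum>b\<in>X (Suc n). \<Sum>u\<in>Pi\<^sub>E {1..n} X.
      c (Suc n) b * ((\<Prod>i=1..n. c i (u i)) * x ^ rises n u *
        (if n \<ge> 1 \<and> R (u n) b then x else 1)) * (if R b a then x else 1))"
    unfolding word_sum_to_def sum_PiE_Suc rises_Suc prod_weight_Suc
    by (intro sum.cong refl) (simp add: mult.assoc)
  then show ?thesis
    by (simp only: word_sum_to_def sum_distrib_left sum_distrib_right)
qed

text \<open>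
  Writing \<open>x = 1 + (x - 1)\<close> at the final step, a word either forgets that step or extends a chain
  of marked rises; iterating peels off the final chain.
\<close>

lemma word_sum_to_eq:
  assumes finite_X: "\<And>i. finite (X i)"
  shows "word_sum_to n a = (\<Sum>m\<le>n. (x - 1) ^ m * word_sum (n - m) * chain_sum (n - m) m a)"
proof (induction n arbitrary: a)
  case 0
  then show ?case by (simp add: word_sum_to_0 word_sum_0)
next
  case (Suc n)
  let ?Y = "{b. b \<in> X (Suc n) \<and> R b a}"
  have filter: "(\<Sum>b\<in>X (Suc n). if R b a then c (Suc n) b * word_sum_to n b else 0) =
      (\<Sum>b\<in>?Y. c (Suc n) b * word_sum_to n b)"
    by (rule sum.inter_filter[symmetric]) (rule finite_X)
  have "word_sum_to (Suc n) a =
      (\<Sum>b\<in>X (Suc n). c (Suc n) b * word_sum_to n b +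
        (x - 1) * (if R b a then c (Suc n) b * word_sum_to n b else 0))"
    unfolding word_sum_to_Suc by (intro sum.cong refl) (simp add: algebra_simps)
  also have "\<dots> = word_sum (Suc n) + (x - 1) * (\<Sum>b\<in>?Y. c (Suc n) b * word_sum_to n b)"
    by (simp only: word_sum_Suc sum.distrib filter flip: sum_distrib_left)
  also have "(\<Sum>b\<in>?Y. c (Suc n) b * word_sum_to n b) =
      (\<Sum>b\<in>?Y. \<Sum>m\<le>n. (x - 1) ^ m * word_sum (n - m) *
        (c (Suc n) b * chain_sum (n - m) m b))"
    unfolding Suc.IH by (simp add: sum_distrib_left mult_ac)
  also have "\<dots> = (\<Sum>m\<le>n. (x - 1) ^ m * word_sum (n - m) *
      (\<Sum>b\<in>?Y. c (Suc n) b * chain_sum (n - m) m b))"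
    by (subst sum.swap) (simp add: sum_distrib_left)
  also have "\<dots> = (\<Sum>m\<le>n. (x - 1) ^ m * word_sum (n - m) * chain_sum (n - m) (Suc m) a)"
    by (intro sum.cong refl) simp
  finally show ?case
    by (subst sum.atMost_Suc_shift) (simp add: sum_distrib_left mult_ac del: chain_sum.simps(2))
qed

text \<open>The final chain has \<open>Suc m\<close> letters but only \<open>m\<close> marked rises,
  hence the exponent \<open>m\<close> of \<open>x - 1\<close>.\<close>

lemma word_sum_Suc_eq:
  assumes "\<And>i. finite (X i)"
  shows "word_sum (Suc n) = (\<Sum>m\<le>n. (x - 1) ^ m * word_sum (n - m) *
     (\<Sum>b\<in>X (Suc n). c (Suc n) b * chain_sum (n - m) m b))"
  unfolding word_sum_Suc word_sum_to_eq[OF assms] sum_distrib_left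
  by (subst sum.swap) (simp add: mult_ac)

end

section \<open>Lehmer codes\<close>

text \<open>Variant of the Lehmer code that looks left and counts smaller entries, so that rises of
  the code are rises of the permutation.\<close>

definition perm_code :: "(nat \<Rightarrow> nat) \<Rightarrow> nat \<Rightarrow> nat" where
  "perm_code \<sigma> i = card {j \<in> {1..<i}. \<sigma> j < \<sigma> i}"

lemma perm_code_less: "i \<ge> 1 \<Longrightarrow> perm_code \<sigma> i < i"
proof -
  assume "i \<ge> 1"
  have "perm_code \<sigma> i \<le> card {1..<i}" unfolding perm_code_def by (rule card_mono) auto
  with \<open>i \<ge> 1\<close> show ?thesis by simp
qed

text \<open>At a rise every index counted for \<open>i\<close> is counted for \<open>i + 1\<close>,
  and \<open>i\<close> itself is new. At a descent every index counted for \<open>i + 1\<close> is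
  already counted for \<open>i\<close>.\<close>

lemma perm_code_rise_iff:
  assumes "inj \<sigma>" and "i \<ge> 1"
  shows "perm_code \<sigma> i < perm_code \<sigma> (i + 1) \<longleftrightarrow> \<sigma> i < \<sigma> (i + 1)"
proof (cases "\<sigma> i < \<sigma> (i + 1)")
  case True
  have "perm_code \<sigma> i < perm_code \<sigma> (i + 1)"
    unfolding perm_code_def
  proof (rule psubset_card_mono)
    show "{j \<in> {1..<i}. \<sigma> j < \<sigma> i} \<subset> {j \<in> {1..<i + 1}. \<sigma> j < \<sigma> (i + 1)}"
      using True assms(2) by (intro psubsetI) (auto simp: set_eq_iff)
  qed simp
  with True show ?thesis by simp
next
  case False
  have "\<sigma> i \<noteq> \<sigma> (i + 1)" using assms(1) by (simp add: inj_eq)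
  with False have "perm_code \<sigma> (i + 1) \<le> perm_code \<sigma> i"
    unfolding perm_code_def by (intro card_mono) (auto simp: less_Suc_eq)
  with False show ?thesis by simp
qed

lemma card_pairs_less:
  "card {(i, j). i \<in> {1..n} \<and> j \<in> {1..n} \<and> i < j \<and> P i j} =
    (\<Sum>j=1..n. card {i \<in> {1..<j::nat}. P i j})"
proof -
  have "{(i, j). i \<in> {1..n} \<and> j \<in> {1..n} \<and> i < j \<and> P i j} =
      prod.swap ` (SIGMA j:{1..n}. {i \<in> {1..<j}. P i j})"
    by (auto simp: image_iff)
  then show ?thesis by (simp add: card_image)
qed

lemma perm_coinv_eq_sum_code: "perm_coinv n \<sigma> = (\<Sum>i=1..n. perm_code \<sigma> i)"
  unfolding perm_coinv_def perm_code_def card_pairs_less ..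

lemma perm_inv_eq_sum_code:
  assumes "inj \<sigma>"
  shows "perm_inv n \<sigma> = (\<Sum>i=1..n. i - 1 - perm_code \<sigma> i)"
  unfolding perm_inv_def card_pairs_less
proof (rule sum.cong)
  fix j
  have set: "{i \<in> {1..<j}. \<sigma> j < \<sigma> i} = {1..<j} - {i \<in> {1..<j}. \<sigma> i < \<sigma> j}"
    using assms by (auto simp: not_less le_less inj_eq)
  have "card {i \<in> {1..<j}. \<sigma> j < \<sigma> i} = card {1..<j} - perm_code \<sigma> j"
    unfolding perm_code_def set by (rule card_Diff_subset) auto
  then show "card {i \<in> {1..<j}. \<sigma> i > \<sigma> j} = j - 1 - perm_code \<sigma> j"
    by simp
qed simp

text \<open>
  Reading the code from the right, \<open>\<sigma> i\<close> is the element of \<open>\<sigma> ` {1..i}\<close> with exactly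
  \<open>perm_code \<sigma> i\<close> smaller elements, and \<open>\<sigma> ` {1..i}\<close> is what the letters to the right leave over.
\<close>

lemma perm_code_inject:
  assumes \<sigma>: "\<sigma> permutes {1..n}" and \<tau>: "\<tau> permutes {1..n}"
    and eq: "\<And>i. i \<in> {1..n} \<Longrightarrow> perm_code \<sigma> i = perm_code \<tau> i"
  shows "\<sigma> = \<tau>"
proof -
  have code: "perm_code \<pi> i = card {y \<in> \<pi> ` {1..i}. y < \<pi> i}" if "\<pi> permutes {1..n}" for \<pi> i
  proof -
    have "inj \<pi>" using that by (rule permutes_inj)
    have "{y \<in> \<pi> ` {1..i}. y < \<pi> i} = \<pi> ` {j \<in> {1..<i}. \<pi> j < \<pi> i}"
      by (auto simp: less_le)
    with \<open>inj \<pi>\<close> show ?thesis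
      unfolding perm_code_def by (simp add: card_image inj_on_subset)
  qed
  have last: "\<sigma> (Suc m) = \<tau> (Suc m)"
    if S: "\<sigma> ` {1..Suc m} = \<tau> ` {1..Suc m}" and "Suc m \<le> n" for m
  proof -
    let ?S = "\<sigma> ` {1..Suc m}"
    \<comment> \<open>Rank in \<open>?S\<close> is strictly increasing, since \<open>a\<close> lies
      below \<open>b\<close> but not below itself. Equal ranks therefore force equal
      entries.\<close>
    have lt: "card {y \<in> ?S. y < a} < card {y \<in> ?S. y < b}" if "a \<in> ?S" "a < b" for a b
      using that by (intro psubset_card_mono psubsetI) (auto simp: set_eq_iff)
    have "card {y \<in> ?S. y < \<sigma> (Suc m)} = card {y \<in> ?S. y < \<tau> (Suc m)}"
      using eq[of "Suc m"] \<open>Suc m \<le> n\<close>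
      unfolding code[OF \<sigma>] code[OF \<tau>] S[symmetric] by simp
    moreover have "\<sigma> (Suc m) \<in> ?S" by simp
    moreover have "\<tau> (Suc m) \<in> ?S" unfolding S by simp
    ultimately show ?thesis
      using lt[of "\<sigma> (Suc m)" "\<tau> (Suc m)"] lt[of "\<tau> (Suc m)" "\<sigma> (Suc m)"]
      by (cases "\<sigma> (Suc m)" "\<tau> (Suc m)" rule: linorder_cases) simp_all
  qed
  have image: "\<sigma> ` {1..m} = \<tau> ` {1..m}" if "m \<le> n" for m
    using that
  \<comment> \<open>Downward induction from \<open>n\<close>, where both images are
    \<open>{1..n}\<close>.\<close>
  proof (induction rule: inc_induct)
    case base
    show ?case using \<sigma> \<tau> by (simp add: permutes_image)
  next
    case (step m)
    have rest: "\<pi> ` {1..m} = \<pi> ` {1..Suc m} - {\<pi> (Suc m)}" if "\<pi> permutes {1..n}" for \<pi>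
      using permutes_inj[OF that] by (auto simp: inj_eq atLeastAtMostSuc_conv)
    show ?case using step rest[OF \<sigma>] rest[OF \<tau>] last[of m]
      by simp
  qed
  show ?thesis
  proof
    fix i
    show "\<sigma> i = \<tau> i"
    proof (cases "i \<in> {1..n}")
      case True
      then show ?thesis using last[of "i - 1"] image[of i] by simp
    next
      case False
      then show ?thesis using \<sigma> \<tau> by (simp add: permutes_not_in)
    qed
  qed
qed

definition wreath_code :: "nat \<Rightarrow> (nat \<Rightarrow> nat) \<times> (nat \<Rightarrow> nat) \<Rightarrow> nat \<Rightarrow> nat \<times> nat" where
  "wreath_code n = (\<lambda>(\<sigma>, w). \<lambda>i\<in>{1..n}. (perm_code \<sigma> i, w i))"

text \<open>No decoding map is built: the code is injective, and both sides have
  \<open>fact n * k ^ n\<close> elements.\<close>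

lemma bij_betw_wreath_code:
  "bij_betw (wreath_code n) (wreath k n) (\<Pi>\<^sub>E i\<in>{1..n}. {..<i} \<times> {..<k})"
proof -
  have inj: "inj_on (wreath_code n) (wreath k n)"
  proof (rule inj_onI, clarify)
    fix \<sigma> w \<tau> z
    assume mem: "(\<sigma>, w) \<in> wreath k n" "(\<tau>, z) \<in> wreath k n"
      and "wreath_code n (\<sigma>, w) = wreath_code n (\<tau>, z)"
    then have eq: "perm_code \<sigma> i = perm_code \<tau> i \<and> w i = z i" if "i \<in> {1..n}" for i
      using that by (auto simp: wreath_code_def restrict_def fun_eq_iff split: if_splits)
    have "\<sigma> = \<tau>" using mem eq by (intro perm_code_inject[of _ n]) (auto simp: wreath_def)
    moreover have "w = z"
      using mem eq by (intro PiE_ext[of w "{1..n}" "\<lambda>_. {0..<k}"]) (auto simp: wreath_def)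
    ultimately show "\<sigma> = \<tau> \<and> w = z" by simp
  qed
  have "wreath_code n ` wreath k n \<subseteq> (\<Pi>\<^sub>E i\<in>{1..n}. {..<i} \<times> {..<k})"
    by (auto simp: wreath_code_def wreath_def perm_code_less PiE_iff)
  moreover have "card (wreath_code n ` wreath k n) = card (\<Pi>\<^sub>E i\<in>{1..n}. {..<i} \<times> {..<k})"
    unfolding card_image[OF inj] unfolding wreath_def card_cartesian_product
    by (subst card_permutations[of _ n]) (simp_all add: card_PiE prod.distrib fact_prod)
  ultimately have "wreath_code n ` wreath k n = (\<Pi>\<^sub>E i\<in>{1..n}. {..<i} \<times> {..<k})"
    by (intro card_subset_eq finite_PiE) auto
  with inj show ?thesis by (simp add: bij_betw_def)
qed

section \<open>The generating function\<close>

abbreviation code_letters :: "nat \<Rightarrow> nat \<Rightarrow> (nat \<times> nat) set" where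
  "code_letters k i \<equiv> {..<i} \<times> {..<k}"

definition code_weight :: "'a::field \<Rightarrow> 'a \<Rightarrow> 'a \<Rightarrow> nat \<Rightarrow> nat \<times> nat \<Rightarrow> 'a" where
  "code_weight p q r i = (\<lambda>(v, w). q ^ (i - 1 - v) * p ^ v * r ^ w)"

definition both_less :: "nat \<times> nat \<Rightarrow> nat \<times> nat \<Rightarrow> bool" where
  "both_less a b \<longleftrightarrow> fst a < fst b \<and> snd a < snd b"

abbreviation code_sum :: "'a::field \<Rightarrow> 'a \<Rightarrow> 'a \<Rightarrow> 'a \<Rightarrow> nat \<Rightarrow> nat \<Rightarrow> 'a" where
  "code_sum p q r x k \<equiv> word_sum (code_letters k) (code_weight p q r) both_less x"

abbreviation code_chain_sum ::
    "'a::field \<Rightarrow> 'a \<Rightarrow> 'a \<Rightarrow> nat \<Rightarrow> nat \<Rightarrow> nat \<Rightarrow> nat \<times> nat \<Rightarrow> 'a" where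
  "code_chain_sum p q r k \<equiv> chain_sum (code_letters k) (code_weight p q r) both_less"

lemma sum_wreath_eq_code_sum:
  "(\<Sum>(\<sigma>, w)\<in>wreath k n.
      q ^ perm_inv n \<sigma> * p ^ perm_coinv n \<sigma> * r ^ word_weight n w * x ^ sris n \<sigma> w) =
    code_sum p q r x k n"
  unfolding word_sum_def sum.reindex_bij_betw[OF bij_betw_wreath_code[of n k], symmetric]
proof (rule sum.cong, simp, clarify)
  fix \<sigma> w assume "(\<sigma>, w) \<in> wreath k n"
  then have "inj \<sigma>" by (auto simp: wreath_def dest: permutes_inj)
  have "(\<Prod>i=1..n. code_weight p q r i (wreath_code n (\<sigma>, w) i)) =
      (\<Prod>i=1..n. q ^ (i - 1 - perm_code \<sigma> i) * p ^ perm_code \<sigma> i * r ^ w i)"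
    by (rule prod.cong) (simp_all add: code_weight_def wreath_code_def)
  also have "\<dots> = q ^ perm_inv n \<sigma> * p ^ perm_coinv n \<sigma> * r ^ word_weight n w"
    by (simp add: prod.distrib power_sum word_weight_def perm_coinv_eq_sum_code
        perm_inv_eq_sum_code[OF \<open>inj \<sigma>\<close>])
  finally have weight: "(\<Prod>i=1..n. code_weight p q r i (wreath_code n (\<sigma>, w) i)) = \<dots>" .
  have "rises both_less n (wreath_code n (\<sigma>, w)) = sris n \<sigma> w"
    unfolding rises_def sris_def
    using perm_code_rise_iff[OF \<open>inj \<sigma>\<close>]
    by (intro arg_cong[of _ _ card] Collect_cong) (auto simp: both_less_def wreath_code_def)
  with weight show "q ^ perm_inv n \<sigma> * p ^ perm_coinv n \<sigma> * r ^ word_weight n w * x ^ sris n \<sigma> w =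
      (\<Prod>i=1..n. code_weight p q r i (wreath_code n (\<sigma>, w) i)) *
        x ^ rises both_less n (wreath_code n (\<sigma>, w))"
    by simp
qed

text \<open>Weight and order are both products over the two coordinates, so each step of the chain
  sum splits into two hockey-stick sums.\<close>

lemma code_chain_sum_eq:
  assumes pq: "\<And>n. n > 0 \<Longrightarrow> pq_num p q n \<noteq> 0" and r: "\<And>n. n > 0 \<Longrightarrow> r_num r n \<noteq> 0"
    and "v \<le> M + m" and "w \<le> k"
  shows "code_chain_sum p q r k M m (v, w) =
    p ^ (m choose 2) * q ^ (m * (M + m - v)) * pq_binom p q v m *
    (r ^ (m choose 2) * r_binom r w m)"
  using assms(3,4)
proof (induction m arbitrary: v w)
  case 0
  have "\<And>n. n > 0 \<Longrightarrow> pq_num r 1 n \<noteq> 0" using r by (simp add: r_num_eq_pq_num)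
  then show ?case
    by (simp add: r_binom_eq_pq_binom pq_binom_0_right pq numeral_2_eq_2)
next
  case (Suc m)
  define s where "s = M + m"
  have r1: "\<And>n. n > 0 \<Longrightarrow> pq_num r 1 n \<noteq> 0" using r by (simp add: r_num_eq_pq_num)
  \<comment> \<open>The bounds on \<open>v\<close> and \<open>w\<close> put the whole box below
    \<open>(v, w)\<close> inside the alphabet.\<close>
  have set: "{b. b \<in> code_letters k (Suc s) \<and> both_less b (v, w)} = {..<v} \<times> {..<w}"
    using Suc.prems by (auto simp: both_less_def s_def)
  have "code_chain_sum p q r k M (Suc m) (v, w) =
      (\<Sum>(v', w')\<in>{..<v} \<times> {..<w}.
        code_weight p q r (Suc s) (v', w') * code_chain_sum p q r k M m (v', w'))"
    by (simp add: set flip: s_def)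
  \<comment> \<open>The powers of 1 bring the second factor into the exact form of the hockey-stick
    sum for \<open>(r, 1)\<close>, with \<open>w\<close> in the role of \<open>s\<close>.\<close>
  also have "\<dots> = (\<Sum>(v', w')\<in>{..<v} \<times> {..<w}.
      (q ^ (s - v') * p ^ v' * (p ^ (m choose 2) * q ^ (m * (s - v')) * pq_binom p q v' m)) *
      (1 ^ (w - w') * r ^ w' * (r ^ (m choose 2) * 1 ^ (m * (w - w')) * pq_binom r 1 w' m)))"
  proof (rule sum.cong, simp, clarify)
    fix v' w' assume "v' < v" "w' < w"
    then have "code_chain_sum p q r k M m (v', w') =
        p ^ (m choose 2) * q ^ (m * (s - v')) * pq_binom p q v' m *
        (r ^ (m choose 2) * r_binom r w' m)"
      unfolding s_def using Suc.prems by (intro Suc.IH) auto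
    then show "code_weight p q r (Suc s) (v', w') * code_chain_sum p q r k M m (v', w') =
      (q ^ (s - v') * p ^ v' * (p ^ (m choose 2) * q ^ (m * (s - v')) * pq_binom p q v' m)) *
      (1 ^ (w - w') * r ^ w' * (r ^ (m choose 2) * 1 ^ (m * (w - w')) * pq_binom r 1 w' m))"
      by (simp add: code_weight_def r_binom_eq_pq_binom)
  qed
  also have "\<dots> =
      (\<Sum>v'<v. q ^ (s - v') * p ^ v' *
        (p ^ (m choose 2) * q ^ (m * (s - v')) * pq_binom p q v' m)) *
      (\<Sum>w'<w. 1 ^ (w - w') * r ^ w' *
        (r ^ (m choose 2) * 1 ^ (m * (w - w')) * pq_binom r 1 w' m))"
    unfolding sum_product sum.cartesian_product ..
  also have "\<dots> = p ^ (Suc m choose 2) * q ^ (Suc m * (Suc s - v)) * pq_binom p q v (Suc m) *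
      (r ^ (Suc m choose 2) * 1 ^ (Suc m * (Suc w - w)) * pq_binom r 1 w (Suc m))"
    using Suc.prems by (intro arg_cong2[of _ _ _ _ times] pq_binom_hockey_stick pq r1)
      (auto simp: s_def)
  finally show ?case by (simp add: s_def r_binom_eq_pq_binom del: chain_sum.simps)
qed

lemma code_sum_Suc:
  assumes pq: "\<And>n. n > 0 \<Longrightarrow> pq_num p q n \<noteq> 0" and r: "\<And>n. n > 0 \<Longrightarrow> r_num r n \<noteq> 0"
  shows "code_sum p q r x k (Suc n) = (\<Sum>m\<le>n. (x - 1) ^ m * code_sum p q r x k (n - m) *
    (p ^ (Suc m choose 2) * pq_binom p q (Suc n) (Suc m) *
      (r ^ (Suc m choose 2) * r_binom r k (Suc m))))"
proof -
  have "(\<Sum>b\<in>code_letters k (Suc n). code_weight p q r (Suc n) b *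
        code_chain_sum p q r k (n - m) m b) =
      p ^ (Suc m choose 2) * pq_binom p q (Suc n) (Suc m) *
        (r ^ (Suc m choose 2) * r_binom r k (Suc m))" if "m \<le> n" for m
  proof -
    \<comment> \<open>The virtual letter \<open>(Suc n, k)\<close> exceeds every letter, so the free
      sum over the last letter becomes a longer chain sum. Its power of \<open>q\<close> then has
      exponent 0.\<close>
    have "{b. b \<in> code_letters k (Suc n) \<and> both_less b (Suc n, k)} = code_letters k (Suc n)"
      by (auto simp: both_less_def)
    then have "(\<Sum>b\<in>code_letters k (Suc n). code_weight p q r (Suc n) b *
        code_chain_sum p q r k (n - m) m b) = code_chain_sum p q r k (n - m) (Suc m) (Suc n, k)"
      using that by simp
    also have "\<dots> = p ^ (Suc m choose 2) * pq_binom p q (Suc n) (Suc m) *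
        (r ^ (Suc m choose 2) * r_binom r k (Suc m))"
      using that by (subst code_chain_sum_eq[OF pq r]) auto
    finally show ?thesis .
  qed
  then show ?thesis by (subst word_sum_Suc_eq) (auto intro!: sum.cong)
qed

theorem sris_gf_eq:
  fixes p q r x :: "'a::field"
  assumes pq: "\<And>n. n > 0 \<Longrightarrow> pq_num p q n \<noteq> 0" and r: "\<And>n. n > 0 \<Longrightarrow> r_num r n \<noteq> 0"
    and x: "x \<noteq> 1"
  shows "sris_gf p q r x k =
    fps_const (1 - x) / (fps_const (1 - x) + sris_denom_sum p q r x k)"
proof -
  define F where "F = pq_fact p q"
  define A where "A = code_sum p q r x k"
  define G where "G = sris_gf p q r x k"
  define D where "D = fps_const (1 - x) + sris_denom_sum p q r x k"
  have F0: "F n \<noteq> 0" for n unfolding F_def by (rule pq_fact_nonzero[OF pq])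
  have G: "fps_nth G n = A n / F n" for n
    by (simp add: G_def sris_gf_def sum_wreath_eq_code_sum A_def F_def)
  have D0: "fps_nth D 0 = 1 - x" by (simp add: D_def sris_denom_sum_def)
  have DS: "fps_nth D (Suc m) = p ^ (Suc m choose 2) * (x - 1) ^ Suc m / F (Suc m) *
      r ^ (Suc m choose 2) * r_binom r k (Suc m)" for m
    by (simp add: D_def sris_denom_sum_def F_def)
  \<comment> \<open>Above degree 0, the constant term \<open>1 - x\<close> of \<open>D\<close> times
    the coefficient of \<open>G\<close> cancels the remaining sum, which the recurrence
    evaluates.\<close>
  have "D * G = fps_const (1 - x)"
  proof (rule fps_ext)
    fix n
    show "fps_nth (D * G) n = fps_nth (fps_const (1 - x)) n"
    proof (cases n)
      case 0
      then show ?thesis by (simp add: D0 G A_def word_sum_0 F_def)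
    next
      case (Suc n')
      have "(\<Sum>m\<le>n'. fps_nth D (Suc m) * fps_nth G (n' - m)) =
          (\<Sum>m\<le>n'. (x - 1) / F (Suc n') * ((x - 1) ^ m * A (n' - m) *
            (p ^ (Suc m choose 2) * pq_binom p q (Suc n') (Suc m) *
              (r ^ (Suc m choose 2) * r_binom r k (Suc m)))))"
      proof (intro sum.cong refl)
        fix m assume "m \<in> {..n'}"
        \<comment> \<open>The two factorials merge into a binomial because
          \<open>Suc m + (n' - m) = Suc n'\<close>.\<close>
        then have "1 / (F (Suc m) * F (n' - m)) = pq_binom p q (Suc n') (Suc m) / F (Suc n')"
          using F0 by (simp add: pq_binom_def flip: F_def)
        moreover have "fps_nth D (Suc m) * fps_nth G (n' - m) =
            (x - 1) * ((x - 1) ^ m * A (n' - m) *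
              (p ^ (Suc m choose 2) * (r ^ (Suc m choose 2) * r_binom r k (Suc m)))) *
            (1 / (F (Suc m) * F (n' - m)))"
          by (simp add: DS G)
        ultimately show "fps_nth D (Suc m) * fps_nth G (n' - m) =
            (x - 1) / F (Suc n') * ((x - 1) ^ m * A (n' - m) *
              (p ^ (Suc m choose 2) * pq_binom p q (Suc n') (Suc m) *
                (r ^ (Suc m choose 2) * r_binom r k (Suc m))))"
          by (simp add: mult_ac)
      qed
      also have "\<dots> = (x - 1) / F (Suc n') * A (Suc n')"
        by (simp only: A_def code_sum_Suc[OF pq r] sum_distrib_left)
      finally have "(\<Sum>m\<le>n'. fps_nth D (Suc m) * fps_nth G (n' - m)) =
          (x - 1) / F (Suc n') * A (Suc n')" .
      moreover have "fps_nth (D * G) (Suc n') =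
          fps_nth D 0 * fps_nth G (Suc n') + (\<Sum>m\<le>n'. fps_nth D (Suc m) * fps_nth G (n' - m))"
        unfolding fps_mult_nth atLeast0AtMost by (subst sum.atMost_Suc_shift) simp
      ultimately show ?thesis by (simp add: Suc D0 G field_simps F0)
    qed
  qed
  moreover have "D \<noteq> 0" using D0 x by auto
  ultimately have "G = fps_const (1 - x) / D"
    by (metis nonzero_mult_div_cancel_left)
  then show ?thesis by (simp add: G_def D_def)
qed

section \<open>Non-vanishing in the field of rational functions\<close>

lemma Fract_one_power: "Fract a 1 ^ n = Fract (a ^ n) 1"
  by (induction n) (simp_all add: fract_collapse)

lemma Fract_one_sum: "(\<Sum>i\<in>S. Fract (f i) 1) = Fract (\<Sum>i\<in>S. f i) 1"
  by (induction S rule: infinite_finite_induct) (simp_all add: fract_collapse)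

text \<open>Both non-vanishing statements follow by specialising \<open>p = q = r = 1\<close>.\<close>

lemma pq_num_var_nonzero:
  assumes "n > 0"
  shows "pq_num var_p var_q n \<noteq> 0"
proof -
  define P :: "rat poly poly poly poly" where
    "P = (\<Sum>i<n. [:[:[:[:0, 1:]:]:]:] ^ (n - 1 - i) * [:[:[:0, 1:]:]:] ^ i)"
  have "pq_num var_p var_q n = Fract P 1"
    by (simp add: pq_num_def var_p_def var_q_def P_def Fract_one_power Fract_one_sum)
  \<comment> \<open>Evaluation runs from the outermost variable inwards: \<open>x\<close> and
    \<open>r\<close> at 0, then \<open>q\<close> and \<open>p\<close> at 1.\<close>
  moreover have "poly (poly (poly (poly P 0) 0) 1) 1 = of_nat n"
    by (simp add: P_def poly_sum)
  then have "P \<noteq> 0" using assms by auto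
  ultimately show ?thesis by (simp add: Zero_fract_def eq_fract)
qed

lemma r_num_var_nonzero:
  assumes "n > 0"
  shows "r_num var_r n \<noteq> 0"
proof -
  define P :: "rat poly poly poly poly" where "P = (\<Sum>i<n. [:[:0, 1:]:] ^ i)"
  have "r_num var_r n = Fract P 1"
    by (simp add: r_num_def var_r_def P_def Fract_one_power Fract_one_sum)
  \<comment> \<open>Here only \<open>r\<close>, the second layer from outside, is set to 1.\<close>
  moreover have "poly (poly (poly (poly P 0) 1) 0) 0 = of_nat n"
    by (simp add: P_def poly_sum)
  then have "P \<noteq> 0" using assms by auto
  ultimately show ?thesis by (simp add: Zero_fract_def eq_fract)
qed

lemma var_x_neq_one: "var_x \<noteq> 1"
proof -
  have "poly [:0, 1 :: rat poly poly poly:] 0 \<noteq> poly 1 0" by simp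
  then have "[:0, 1 :: rat poly poly poly:] \<noteq> 1" by metis
  then show ?thesis unfolding var_x_def One_fract_def by (simp add: eq_fract(1))
qed

theorem theorem7:
  fixes k :: nat
  assumes "k \<ge> 2"
  shows "sris_gf var_p var_q var_r var_x k =
    fps_const (1 - var_x) / (fps_const (1 - var_x) + sris_denom_sum var_p var_q var_r var_x k)"
  by (rule sris_gf_eq) (simp_all add: pq_num_var_nonzero r_num_var_nonzero var_x_neq_one)

end
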